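(* Let $n\ge 1$ be an integer and let $W(3,n)$ be the weaving link, i.e. the closure of the 3-braid $(\sigma_1\sigma_2^{-1})^n$. Put $s=-t$. Then the Jones polynomial of $W(3,n)$, written in the variable $s$, is $$V_{W(3,n)}(s)=-s-s^{-1}+s^{-n}C_n(s)=\sum_{k=0}^{2n}a_k\,s^{k-n},\qquad a_k=\begin{cases}c_{n,k}&\text{if }|k-n|\ne 1,\\ c_{n,k}-1&\text{if }|k-n|=1,\end{cases}$$ where $C_n(q)=\sum_{k=0}^{2n}c_{n,k}q^k$ is the rank polynomial of the Lucas lattice and $c_{n,k}$ are its Whitney numbers.
   Context: $B_3=\langle\sigma_1,\sigma_2\mid \sigma_1\sigma_2\sigma_1=\sigma_2\sigma_1\sigma_2\rangle$ is the braid group on 3 strands. The (reduced) Burau representation $\psi_t:B_3\to GL(2,\mathbb{Z}[t,t^{-1}])$ is given by $$\psi_t(\sigma_1)=\begin{pmatrix}-t&1\\0&1\end{pmatrix},\qquad \psi_t(\sigma_2)=\begin{pmatrix}1&0\\t&-t\end{pmatrix}.$$ For a 3-braid $\alpha$ with exponent sum $e_\alpha$ and closure $\hat\alpha$, the Jones polynomial (normalized to be $1$ on the unknot) is given by Birman's formula $V_{\hat\alpha}(t)=(-\sqrt t)^{e_\alpha}(t+t^{-1}+\operatorname{tr}(\psi_t(\alpha)))$. $V_L(s)$ denotes the Jones polynomial rewritten in the variable $s=-t$ (that is, with $t=-s$ substituted). The Whitney numbers $c_{n,k}$ ($n\ge1$, $0\le k\le 2n$) of the Lucas lattice are given explicitly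 by $$c_{n,k}=\begin{cases}\displaystyle\sum_{j=0}^{\lfloor k/2\rfloor}\frac{n}{n-j}\binom{n-j}{n-k+j}\binom{k-j-1}{j}&k<2n,\\ 1&k=2n,\end{cases}$$ with the conventions $\binom{a}{0}=1$ for every integer $a$ (including $a=-1$) and $\binom{a}{b}=0$ if $b<0$ or $b>a\ge 0$. The rank polynomial is $C_n(q)=\sum_{k=0}^{2n}c_{n,k}q^k$; it is known (Munarini–Zagaglia Salvi) that $C_n(q)=2q^nT_n\!\left(\frac{1+q+q^2}{2q}\right)$, where $T_n$ is the Chebyshev polynomial of the first kind. *)

theory Defs
  imports "HOL-Analysis.Determinants" "HOL-Library.Poly_Mapping"
begin

section \<open>The braid group on three strands\<close>

datatype gen = S1 | S2

text \<open>A letter \<open>(g, True)\<close> stands for the generator \<open>g\<close>, and \<open>(g, False)\<close> for its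
  inverse.\<close>

type_synonym word = "(gen \<times> bool) list"

inductive braid_eq :: "word \<Rightarrow> word \<Rightarrow> bool" where
  refl: "braid_eq w w"
| sym: "braid_eq v w \<Longrightarrow> braid_eq w v"
| trans: "braid_eq u v \<Longrightarrow> braid_eq v w \<Longrightarrow> braid_eq u w"
| append: "braid_eq v v' \<Longrightarrow> braid_eq w w' \<Longrightarrow> braid_eq (v @ w) (v' @ w')"
| cancel: "braid_eq [(g, b), (g, \<not> b)] []"
| braid: "braid_eq [(S1, True), (S2, True), (S1, True)] [(S2, True), (S1, True), (S2, True)]"

quotient_type braid3 = word / braid_eq
  by (intro equivpI reflpI sympI transpI) (blast intro: braid_eq.intros)+

definition inv_word :: "word \<Rightarrow> word" where
  "inv_word w = rev (map (\<lambda>(g, b). (g, \<not> b)) w)"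

lemma inv_word_append: "inv_word (v @ w) = inv_word w @ inv_word v"
  by (simp add: inv_word_def)

lemma braid_eq_right_inverse: "braid_eq (w @ inv_word w) []"
proof (induction w)
  case Nil
  show ?case by (simp add: inv_word_def braid_eq.refl)
next
  case (Cons x w)
  obtain g b where x: "x = (g, b)" by (cases x)
  have "braid_eq ([x] @ ((w @ inv_word w) @ [(g, \<not> b)])) ([x] @ ([] @ [(g, \<not> b)]))"
    by (intro braid_eq.append braid_eq.refl Cons.IH)
  also have "[x] @ ([] @ [(g, \<not> b)]) = [(g, b), (g, \<not> b)]" by (simp add: x)
  finally have "braid_eq ([x] @ ((w @ inv_word w) @ [(g, \<not> b)])) []"
    by (rule braid_eq.trans) (rule braid_eq.cancel)
  then show ?case by (simp add: x inv_word_def)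
qed

lemma inv_word_inv_word [simp]: "inv_word (inv_word w) = w"
  by (induction w) (auto simp: inv_word_def)

lemma braid_eq_left_inverse: "braid_eq (inv_word w @ w) []"
  using braid_eq_right_inverse[of "inv_word w"] by simp

lemma braid_eq_inv_word:
  assumes "braid_eq v w"
  shows "braid_eq (inv_word v) (inv_word w)"
proof -
  have "braid_eq (inv_word v @ (w @ inv_word w)) (inv_word v @ [])"
    by (intro braid_eq.append braid_eq.refl braid_eq_right_inverse)
  then have 1: "braid_eq (inv_word v) ((inv_word v @ w) @ inv_word w)"
    using braid_eq.sym by force
  have "braid_eq ((inv_word v @ w) @ inv_word w) ((inv_word v @ v) @ inv_word w)"
    by (intro braid_eq.append braid_eq.refl braid_eq.sym[OF assms])
  moreover have "braid_eq ((inv_word v @ v) @ inv_word w) ([] @ inv_word w)"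
    by (intro braid_eq.append braid_eq.refl braid_eq_left_inverse)
  ultimately show ?thesis using 1 by (metis append_Nil braid_eq.trans)
qed

instantiation braid3 :: "{monoid_mult, inverse}"
begin

lift_definition one_braid3 :: braid3 is "[]" .

lift_definition times_braid3 :: "braid3 \<Rightarrow> braid3 \<Rightarrow> braid3" is "(@)"
  by (rule braid_eq.append)

lift_definition inverse_braid3 :: "braid3 \<Rightarrow> braid3" is inv_word
  by (rule braid_eq_inv_word)

definition divide_braid3 :: "braid3 \<Rightarrow> braid3 \<Rightarrow> braid3" where
  "divide_braid3 a b = a * inverse b"

instance
  by standard (transfer; simp add: braid_eq.refl)+

end

lift_definition sigma :: "gen \<Rightarrow> braid3" is "\<lambda>g. [(g, True)]" .

abbreviation sigma1 :: braid3 where "sigma1 \<equiv> sigma S1"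
abbreviation sigma2 :: braid3 where "sigma2 \<equiv> sigma S2"

lemma braid3_left_inverse: "inverse a * a = (1 :: braid3)"
  by transfer (rule braid_eq_left_inverse)

lemma braid3_right_inverse: "a * inverse a = (1 :: braid3)"
  by transfer (rule braid_eq_right_inverse)

lemma braid3_relation: "sigma1 * sigma2 * sigma1 = sigma2 * sigma1 * sigma2"
  by transfer (simp add: braid_eq.braid)

definition exponent_sum_word :: "word \<Rightarrow> int" where
  "exponent_sum_word w = (\<Sum>(g, b)\<leftarrow>w. if b then 1 else -1)"

lift_definition exponent_sum :: "braid3 \<Rightarrow> int" is exponent_sum_word
proof -
  fix v w
  assume "braid_eq v w"
  then show "exponent_sum_word v = exponent_sum_word w"
    by induction (auto simp: exponent_sum_word_def)
qed

lemma exponent_sum_simps [simp]: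
  "exponent_sum 1 = 0"
  "exponent_sum (a * b) = exponent_sum a + exponent_sum b"
  "exponent_sum (sigma g) = 1"
  by (transfer; simp add: exponent_sum_word_def)+

section \<open>Laurent polynomials\<close>

text \<open>The ring of Laurent polynomials is the group ring of the integers: the monomial
  \<open>c x\<^sup>k\<close> is \<open>Poly_Mapping.single k c\<close>, and multiplication of finitely supported
  functions is convolution.\<close>

type_synonym 'a laurent = "int \<Rightarrow>\<^sub>0 'a"

abbreviation lmonom :: "'a::zero \<Rightarrow> int \<Rightarrow> 'a laurent" where
  "lmonom c k \<equiv> Poly_Mapping.single k c"

text \<open>The substitution \<open>x = c y\<^sup>m\<close>, intended for \<open>c \<in> {1, -1}\<close> only: then \<open>c\<close> is its own
  inverse and \<open>c ^ nat \<bar>k\<bar>\<close> is the \<open>k\<close>-th power of \<open>c\<close> for negative \<open>k\<close> as well.\<close>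

definition lsubst :: "'a::comm_ring_1 \<Rightarrow> int \<Rightarrow> 'a laurent \<Rightarrow> 'a laurent" where
  "lsubst c m P =
     (\<Sum>k\<in>Poly_Mapping.keys P. lmonom (Poly_Mapping.lookup P k * c ^ nat \<bar>k\<bar>) (m * k))"

lemma lookup_lsubst:
  assumes "m \<noteq> 0"
  shows "Poly_Mapping.lookup (lsubst c m P) (m * k) = Poly_Mapping.lookup P k * c ^ nat \<bar>k\<bar>"
proof -
  have "Poly_Mapping.lookup (lsubst c m P) (m * k) =
      (\<Sum>i\<in>Poly_Mapping.keys P. if i = k then Poly_Mapping.lookup P k * c ^ nat \<bar>k\<bar> else 0)"
    unfolding lsubst_def lookup_sum using assms
    by (intro sum.cong) (auto simp: lookup_single when_def)
  then show ?thesis by (simp add: in_keys_iff)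
qed

text \<open>The inclusion of integer into rational Laurent polynomials.\<close>

definition rat_laurent :: "int laurent \<Rightarrow> rat laurent" where
  "rat_laurent P = Poly_Mapping.map of_int P"

section \<open>The reduced Burau representation\<close>

abbreviation tvar :: "int laurent" where "tvar \<equiv> lmonom 1 1"

abbreviation tinv :: "int laurent" where "tinv \<equiv> lmonom 1 (-1)"

fun burau_gen :: "gen \<Rightarrow> int laurent ^ 2 ^ 2" where
  "burau_gen S1 = vector [vector [- tvar, 1], vector [0, 1]]"
| "burau_gen S2 = vector [vector [1, 0], vector [tvar, - tvar]]"

fun burau_letter :: "gen \<times> bool \<Rightarrow> int laurent ^ 2 ^ 2" where
  "burau_letter (g, True) = burau_gen g"
| "burau_letter (g, False) = matrix_inv (burau_gen g)"

definition burau_word :: "word \<Rightarrow> int laurent ^ 2 ^ 2" where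
  "burau_word w = foldr (\<lambda>x A. burau_letter x ** A) w (mat 1)"

lemma burau_word_append: "burau_word (v @ w) = burau_word v ** burau_word w"
  by (induction v) (auto simp: burau_word_def matrix_mul_assoc)

lemma tvar_tinv: "tvar * tinv = 1" "tinv * tvar = 1"
  by (simp_all add: mult_single)

lemma invertible_burau_gen: "invertible (burau_gen g)"
proof (cases g)
  case S1
  show ?thesis unfolding invertible_def S1
    by (rule exI[of _ "vector [vector [- tinv, tinv], vector [0, 1]]"])
      (simp add: matrix_matrix_mult_def mat_def vec_eq_iff forall_2 sum_2 tvar_tinv)
next
  case S2
  show ?thesis unfolding invertible_def S2
    by (rule exI[of _ "vector [vector [1, 0], vector [1, - tinv]]"])
      (simp add: matrix_matrix_mult_def mat_def vec_eq_iff forall_2 sum_2 tvar_tinv)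
qed

lemma burau_gen_inverse:
  "burau_gen g ** matrix_inv (burau_gen g) = mat 1"
  "matrix_inv (burau_gen g) ** burau_gen g = mat 1"
  using someI_ex[OF invertible_burau_gen[of g, unfolded invertible_def]]
  by (simp_all add: matrix_inv_def)

lift_definition burau :: "braid3 \<Rightarrow> int laurent ^ 2 ^ 2" is burau_word
proof -
  fix v w
  assume "braid_eq v w"
  then show "burau_word v = burau_word w"
  proof induction
    case (cancel g b)
    then show ?case
      by (cases b) (simp_all add: burau_word_def burau_gen_inverse)
  next
    case braid
    show ?case
      by (simp add: burau_word_def matrix_matrix_mult_def mat_def vec_eq_iff forall_2 sum_2
          algebra_simps)
  qed (simp_all add: burau_word_append)
qed

lemma burau_simps:
  "burau 1 = mat 1"
  "burau (a * b) = burau a ** burau b"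
  "burau (sigma g) = burau_gen g"
  subgoal by transfer (simp add: burau_word_def)
  subgoal by transfer (rule burau_word_append)
  subgoal by transfer (simp add: burau_word_def)
  done

section \<open>The Jones polynomial of closed 3-braids\<close>

text \<open>Birman's formula for the Jones polynomial of the closure of \<open>\<alpha>\<close>, normalized to be 1
  on the unknot, is taken as the definition. The result is a Laurent polynomial in the variable
  \<open>u = sqrt t\<close>: the first factor is \<open>(-u)\<^sup>e\<close> for the exponent sum \<open>e\<close>, and the second one
  becomes a Laurent polynomial in \<open>u\<close> by \<open>t = u\<^sup>2\<close>.\<close>

definition jones_closure :: "braid3 \<Rightarrow> int laurent" where
  "jones_closure \<alpha> =
     lmonom ((-1) ^ nat \<bar>exponent_sum \<alpha>\<bar>) (exponent_sum \<alpha>) *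
     lsubst 1 2 (tvar + tinv + trace (burau \<alpha>))"

text \<open>The closure of \<open>sigma1 * sigma2\<close> is the unknot.\<close>

lemma jones_closure_unknot: "jones_closure (sigma1 * sigma2) = 1"
proof -
  have "tvar + tinv + trace (burau (sigma1 * sigma2)) = tinv"
    by (simp add: burau_simps trace_def sum_2 matrix_matrix_mult_def)
  then show ?thesis
    unfolding jones_closure_def by (simp only:) (simp add: lsubst_def mult_single)
qed

text \<open>For \<open>P\<close> in the variable \<open>s = -t\<close>, this is \<open>P(-t)\<close> in the variable \<open>u = sqrt t\<close>,
  so \<open>s = -u\<^sup>2\<close>. By injectivity, \<open>V = at_s P\<close> says that \<open>V\<close> rewritten in \<open>s\<close> is \<open>P\<close>.\<close>

definition at_s :: "rat laurent \<Rightarrow> rat laurent" where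
  "at_s P = lsubst (-1) 2 P"

lemma inj_at_s: "inj at_s"
proof (rule injI)
  fix P Q
  assume "at_s P = at_s Q"
  then have "Poly_Mapping.lookup P k * (-1) ^ nat \<bar>k\<bar> = Poly_Mapping.lookup Q k * (-1) ^ nat \<bar>k\<bar>" for k
    unfolding at_s_def by (metis lookup_lsubst zero_neq_numeral)
  then show "P = Q" by (intro poly_mapping_eqI) simp
qed

text \<open>The link \<open>W(3,n)\<close> is the closure of the following braid.\<close>

definition weaving_braid :: "nat \<Rightarrow> braid3" where
  "weaving_braid n = (sigma1 * inverse sigma2) ^ n"

section \<open>The rank polynomial of the Lucas lattice\<close>

text \<open>Note that \<open>gbinomial\<close> gives \<open>ibinom a 0 = 1\<close> also for negative \<open>a\<close>, and
  \<open>ibinom a b = 0\<close> for \<open>b > a \<ge> 0\<close>.\<close>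

definition ibinom :: "int \<Rightarrow> int \<Rightarrow> rat" where
  "ibinom a b = (if b < 0 then 0 else of_int a gchoose nat b)"

definition lucas_whitney :: "nat \<Rightarrow> nat \<Rightarrow> rat" where
  "lucas_whitney n k =
     (if k < 2 * n then
        \<Sum>j = 0..k div 2. of_nat n / (of_nat n - of_nat j)
          * ibinom (int n - int j) (int n - int k + int j)
          * ibinom (int k - int j - 1) (int j)
      else if k = 2 * n then 1 else 0)"

definition lucas_rank_poly :: "nat \<Rightarrow> rat laurent" where
  "lucas_rank_poly n = (\<Sum>k = 0..2 * n. lmonom (lucas_whitney n k) (int k))"

end

(* The Burau matrix of \<sigma>1 \<sigma>2^-1 has determinant 1 and trace 1 - t - t^-1 = 1 + s + s^-1, so by
   Cayley-Hamilton the traces T n of its powers satisfy T (n+2) = (1 + s + s^-1) T (n+1) - T n.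
   Hence s^n T n is the n-th power sum p n of the two roots of Z^2 - (w + x + y) Z + w y, taken at
   w = 1, x = s, y = s^2. For n >= 1 the coefficient of x^i y^j w^l in p n, where i + j + l = n, is
   that of y^j w^l in u^i (1/(1-y) + 1/(1-w) - 1) with u = 1/((1-y)(1-w)), because multiplication by
   (1-y)(1-w) lowers i by one. Since the last factor is (i + y d/dy + w d/dw)/i applied to u^i and
   divided by u^i, this coefficient is (n/i) C(i+j-1,j) C(i+l-1,l) if i >= 1. This is the summand of
   the explicit formula for the Whitney numbers, as C(n-j,i)/(n-j) = C(n-j-1,i-1)/i. *)

theory Submission
  imports Defs
begin

section \<open>Power sums of the roots of a quadratic polynomial\<close>

text \<open>The coefficient of \<open>y\<^sup>j\<close> in \<open>1 / (1 - y)\<^sup>i\<close>. For \<open>i = j = 0\<close> the truncated subtraction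
  gives the correct value 1.\<close>

definition multichoose :: "nat \<Rightarrow> int \<Rightarrow> int" where
  "multichoose i j = (if j < 0 then 0 else int ((i + nat j - 1) choose nat j))"

lemma multichoose_0 [simp]: "multichoose 0 j = (if j = 0 then 1 else 0)"
  by (auto simp: multichoose_def)

lemma multichoose_1: "multichoose (Suc 0) j = (if j < 0 then 0 else 1)"
  by (simp add: multichoose_def)

lemma multichoose_neg [simp]: "j < 0 \<Longrightarrow> multichoose i j = 0"
  by (simp add: multichoose_def)

text \<open>Multiplying \<open>1/(1-y)^(i+1)\<close> by \<open>1-y\<close> lowers the exponent by
  one; for positive \<open>j\<close> this is Pascal's rule.\<close>

lemma multichoose_Suc: "multichoose (Suc i) j = multichoose (Suc i) (j - 1) + multichoose i j"
proof (cases "j \<le> 0")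
  case False
  then obtain r where "j = int (Suc r)"
    by (metis gr0_implies_Suc not_le pos_int_cases)
  then show ?thesis by (simp add: multichoose_def nat_add_distrib)
qed (auto simp: multichoose_def)

text \<open>Coefficient form of \<open>(i + y d/dy) (1-y)^(-i) = i (1-y)^(-i-1)\<close>.\<close>

lemma multichoose_absorb:
  "int i * multichoose (Suc i) (int j) = int (i + j) * multichoose i (int j)"
proof (cases i)
  case (Suc h)
  have "Suc h * (Suc (h + j) choose j) = Suc (h + j) * (h + j choose j)"
    using Suc_times_binomial_eq[of "h + j" h] binomial_symmetric[of j "Suc (h + j)"]
      binomial_symmetric[of j "h + j"] by (simp add: mult.commute)
  then have "int (Suc h * (Suc (h + j) choose j)) = int (Suc (h + j) * (h + j choose j))"
    by (rule arg_cong)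
  then show ?thesis by (simp only: Suc multichoose_def) (simp add: algebra_simps)
qed auto

text \<open>The coefficient of \<open>x\<^sup>i y\<^sup>j w\<^sup>l\<close> in the power sum of degree \<open>i + j + l\<close> of the two roots of
  \<open>Z\<^sup>2 - (w + x + y) Z + w y\<close>; the last summand accounts for the power sum of degree 0
  being 2.\<close>

definition power_sum_coeff :: "int \<Rightarrow> int \<Rightarrow> int \<Rightarrow> int" where
  "power_sum_coeff i j l =
     (if i < 0 then 0 else
        multichoose (Suc (nat i)) j * multichoose (nat i) l
        + multichoose (nat i) j * multichoose (Suc (nat i)) l
        - multichoose (nat i) j * multichoose (nat i) l
        + (if i = 0 \<and> j = 0 \<and> l = 0 then 1 else 0))"

lemma power_sum_coeff_neg [simp]:
  "i < 0 \<Longrightarrow> power_sum_coeff i j l = 0"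
  "j < 0 \<Longrightarrow> power_sum_coeff i j l = 0"
  "l < 0 \<Longrightarrow> power_sum_coeff i j l = 0"
  by (auto simp: power_sum_coeff_def)

lemma power_sum_coeff_0:
  "power_sum_coeff 0 j l =
     (if j = 0 \<and> l = 0 then 2 else if j = 0 \<and> l \<ge> 0 \<or> l = 0 \<and> j \<ge> 0 then 1 else 0)"
  by (auto simp: power_sum_coeff_def multichoose_1)

text \<open>Newton's recurrence \<open>p n = (w + x + y) p (n-1) - w y p (n-2)\<close>, read off at
  one monomial. For \<open>i = 0\<close> the power sum is that of \<open>w\<close> and
  \<open>y\<close>.\<close>

lemma power_sum_coeff_rec:
  assumes "i + j + l \<ge> 2"
  shows "power_sum_coeff i j l = power_sum_coeff i j (l - 1) + power_sum_coeff (i - 1) j l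
           + power_sum_coeff i (j - 1) l - power_sum_coeff i (j - 1) (l - 1)"
proof (cases "i \<le> 0")
  case True
  show ?thesis
  proof (cases "i = 0")
    case True
    then show ?thesis using assms by (auto simp: power_sum_coeff_0)
  qed (use True in simp)
next
  case False
  then obtain h where i: "i = int (Suc h)"
    by (metis gr0_implies_Suc not_le pos_int_cases)
  have coeff: "power_sum_coeff (int (Suc h)) j l =
        multichoose (Suc (Suc h)) j * multichoose (Suc h) l
        + multichoose (Suc h) j * multichoose (Suc (Suc h)) l
        - multichoose (Suc h) j * multichoose (Suc h) l" for j l
    by (simp add: power_sum_coeff_def nat_add_distrib)
  have coeff': "power_sum_coeff (int (Suc h) - 1) j l =
        multichoose (Suc h) j * multichoose h l + multichoose h j * multichoose (Suc h) l
        - multichoose h j * multichoose h l"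
  proof -
    \<comment> \<open>Here \<open>h = j = l = 0\<close> would give total degree 1, so the extra
      summand for degree 0 never enters.\<close>
    have "\<not> (h = 0 \<and> j = 0 \<and> l = 0)" using assms i by auto
    then show ?thesis by (auto simp: power_sum_coeff_def)
  qed
  show ?thesis
    unfolding i coeff coeff'
    using multichoose_Suc[of "Suc h" j] multichoose_Suc[of "Suc h" l]
      multichoose_Suc[of h j] multichoose_Suc[of h l]
    by algebra
qed

text \<open>For \<open>i > 0\<close>, absorption in both variables collapses the three products into
  one. The denominator \<open>i + l\<close> in place of \<open>i\<close> lets the same formula cover
  \<open>i = 0\<close>.\<close>

lemma power_sum_coeff_closed:
  assumes "i + l > 0"
  shows "of_int (power_sum_coeff (int i) (int j) (int l)) =
    (of_nat (i + j + l) / of_nat (i + l)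
      * (of_nat (i + l choose l) * of_int (multichoose i (int j))) :: rat)"
proof (cases i)
  case 0
  then show ?thesis using assms by (auto simp: power_sum_coeff_0)
next
  case (Suc h)
  define A A' B B' where "A = multichoose (Suc i) (int j)" "A' = multichoose i (int j)"
    "B = multichoose (Suc i) (int l)" "B' = multichoose i (int l)"
  note defs = this
  have B: "of_nat (i + l choose l) = (of_int B :: rat)"
    by (simp add: defs multichoose_def)
  have "int i * A = int (i + j) * A'" "int i * B = int (i + l) * B'"
    unfolding defs by (rule multichoose_absorb)+
  then have "int (i + l) * (A * B' + A' * B - A' * B') * int i = int (i + j + l) * (B * A') * int i"
    unfolding of_nat_add by algebra
  then have "int (i + l) * (A * B' + A' * B - A' * B') = int (i + j + l) * (B * A')"
    using Suc by simp
  moreover have "power_sum_coeff (int i) (int j) (int l) = A * B' + A' * B - A' * B'"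
    using Suc by (simp add: power_sum_coeff_def defs nat_add_distrib)
  ultimately have "int (i + l) * power_sum_coeff (int i) (int j) (int l) = int (i + j + l) * (B * A')"
    by simp
  then have "(of_int (int (i + l) * power_sum_coeff (int i) (int j) (int l)) :: rat)
      = of_int (int (i + j + l) * (B * A'))"
    by (rule arg_cong)
  then show ?thesis
    unfolding B defs(2)[symmetric] using assms
    by (simp add: nonzero_eq_divide_eq mult_ac flip: of_nat_add)
qed

text \<open>The coefficient of \<open>q\<^sup>k\<close> in the power sum of degree \<open>n\<close> at \<open>w = 1\<close>, \<open>x = q\<close>, \<open>y = q\<^sup>2\<close>.\<close>

definition lucas_coeff :: "nat \<Rightarrow> int \<Rightarrow> int" where
  "lucas_coeff n k = (\<Sum>j = 0..int n. power_sum_coeff (k - 2 * j) j (int n - k + j))"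

section \<open>Recurrence, initial values and support of \<open>lucas_coeff\<close>\<close>

lemma lucas_coeff_extend:
  assumes "finite J" "{0..int n} \<subseteq> J"
  shows "lucas_coeff n k = (\<Sum>j\<in>J. power_sum_coeff (k - 2 * j) j (int n - k + j))"
  unfolding lucas_coeff_def
proof (intro sum.mono_neutral_left assms ballI)
  fix j assume "j \<in> J - {0..int n}"
  \<comment> \<open>The exponents of \<open>x\<close> and \<open>w\<close> add up to
    \<open>n - j\<close>, so one of them is negative once \<open>j > n\<close>.\<close>
  then have "j < 0 \<or> k - 2 * j < 0 \<or> int n - k + j < 0" by auto
  then show "power_sum_coeff (k - 2 * j) j (int n - k + j) = 0" by auto
qed

text \<open>Multiplication by \<open>y = q^2\<close> raises \<open>j\<close> by one; the reindexing
  gives all terms of the recurrence a common range of summation.\<close>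

lemma lucas_coeff_shift:
  assumes "n \<le> N"
  shows "lucas_coeff n (k - 2) =
    (\<Sum>j = 0..int (Suc N). power_sum_coeff (k - 2 * j) (j - 1) (int n - k + 1 + j))"
proof -
  have "lucas_coeff n (k - 2) =
      (\<Sum>j = -1..int N. power_sum_coeff (k - 2 - 2 * j) j (int n - (k - 2) + j))"
    using assms by (intro lucas_coeff_extend) auto
  also have "\<dots> = (\<Sum>j = 0..int (Suc N). power_sum_coeff (k - 2 * j) (j - 1) (int n - k + 1 + j))"
    by (rule sum.reindex_bij_witness[of _ "\<lambda>j. j - 1" "\<lambda>j. j + 1"])
      (auto simp: algebra_simps)
  finally show ?thesis .
qed

lemma lucas_coeff_rec:
  "lucas_coeff (Suc (Suc n)) k = lucas_coeff (Suc n) k + lucas_coeff (Suc n) (k - 1)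
     + lucas_coeff (Suc n) (k - 2) - lucas_coeff n (k - 2)"
proof -
  let ?J = "{0..int (Suc (Suc n))}"
  have "lucas_coeff (Suc n) k = (\<Sum>j\<in>?J. power_sum_coeff (k - 2 * j) j (int (Suc n) - k + j))"
    by (rule lucas_coeff_extend) auto
  moreover have "lucas_coeff (Suc n) (k - 1) =
      (\<Sum>j\<in>?J. power_sum_coeff (k - 1 - 2 * j) j (int (Suc n) - (k - 1) + j))"
    by (rule lucas_coeff_extend) auto
  moreover have "lucas_coeff (Suc n) (k - 2) =
      (\<Sum>j\<in>?J. power_sum_coeff (k - 2 * j) (j - 1) (int (Suc n) - k + 1 + j))"
    by (rule lucas_coeff_shift) simp
  moreover have "lucas_coeff n (k - 2) =
      (\<Sum>j\<in>?J. power_sum_coeff (k - 2 * j) (j - 1) (int n - k + 1 + j))"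
    by (rule lucas_coeff_shift) simp
  moreover have "power_sum_coeff (k - 2 * j) j (int (Suc (Suc n)) - k + j) =
      power_sum_coeff (k - 2 * j) j (int (Suc n) - k + j)
      + power_sum_coeff (k - 1 - 2 * j) j (int (Suc n) - (k - 1) + j)
      + power_sum_coeff (k - 2 * j) (j - 1) (int (Suc n) - k + 1 + j)
      - power_sum_coeff (k - 2 * j) (j - 1) (int n - k + 1 + j)" for j
    using power_sum_coeff_rec[of "k - 2 * j" j "int (Suc (Suc n)) - k + j"]
    by (simp add: algebra_simps)
  ultimately show ?thesis
    unfolding lucas_coeff_def[of "Suc (Suc n)"] by (simp only: sum.distrib sum_subtractf)
qed

lemma lucas_coeff_0: "lucas_coeff 0 k = (if k = 0 then 2 else 0)"
  by (auto simp: lucas_coeff_def power_sum_coeff_def multichoose_1)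

lemma lucas_coeff_1: "lucas_coeff (Suc 0) k = (if k \<in> {0, 1, 2} then 1 else 0)"
proof -
  have "{0..int (Suc 0)} = {0, 1}" by auto
  then have "lucas_coeff (Suc 0) k = power_sum_coeff k 0 (1 - k) + power_sum_coeff (k - 2) 1 (2 - k)"
    by (simp add: lucas_coeff_def)
  moreover have "k < 0 \<or> k = 0 \<or> k = 1 \<or> k = 2 \<or> k > 2" by auto
  ultimately show ?thesis
    by (elim disjE) (auto simp: power_sum_coeff_0 power_sum_coeff_def multichoose_def)
qed

lemma lucas_coeff_outside:
  assumes "k < 0 \<or> k > 2 * int n"
  shows "lucas_coeff n k = 0"
  unfolding lucas_coeff_def
proof (intro sum.neutral ballI)
  fix j assume "j \<in> {0..int n}"
  then have "k - 2 * j < 0 \<or> int n - k + j < 0" using assms by auto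
  then show "power_sum_coeff (k - 2 * j) j (int n - k + j) = 0" by auto
qed

section \<open>Whitney numbers of the Lucas lattice\<close>

lemma ibinom_of_nat: "ibinom (int a) (int b) = of_nat (a choose b)"
  by (simp add: ibinom_def binomial_gbinomial)

text \<open>At \<open>i = j = 0\<close> the upper index is -1, and both conventions give 1.\<close>

lemma ibinom_multichoose: "ibinom (int i + int j - 1) (int j) = of_int (multichoose i (int j))"
proof (cases "i + j = 0")
  case False
  then have "int i + int j - 1 = int (i + j - 1)" by linarith
  then show ?thesis by (simp only: ibinom_of_nat) (simp add: multichoose_def)
qed (simp add: ibinom_def)

lemma lucas_whitney_eq:
  assumes "n \<ge> 1" "k \<le> 2 * n"
  shows "lucas_whitney n k = of_int (lucas_coeff n (int k))"
proof (cases "k = 2 * n")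
  case True
  \<comment> \<open>Only the monomial \<open>y^n\<close> contributes to \<open>q^(2n)\<close>; here
    \<open>i + l = 0\<close>, so the closed form does not apply.\<close>
  have "lucas_coeff n (int k) = (\<Sum>j\<in>{int n}. power_sum_coeff (int k - 2 * j) j (int n - int k + j))"
    unfolding lucas_coeff_def using True by (intro sum.mono_neutral_right) auto
  then show ?thesis using True assms by (simp add: lucas_whitney_def power_sum_coeff_0)
next
  case False
  then have k: "k < 2 * n" using assms by simp
  have "lucas_coeff n (int k) =
      (\<Sum>j\<in>int ` {0..k div 2}. power_sum_coeff (int k - 2 * j) j (int n - int k + j))"
    unfolding lucas_coeff_def
  proof (intro sum.mono_neutral_right ballI)
    show "int ` {0..k div 2} \<subseteq> {0..int n}" using k by auto
    fix j assume j: "j \<in> {0..int n} - int ` {0..k div 2}"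
    then have "j = int (nat j)" by auto
    then have "nat j \<notin> {0..k div 2}" using j by blast
    then have "int k - 2 * j < 0" using j by auto
    then show "power_sum_coeff (int k - 2 * j) j (int n - int k + j) = 0" by simp
  qed simp
  also have "\<dots> = (\<Sum>j = 0..k div 2.
      power_sum_coeff (int k - 2 * int j) (int j) (int n - int k + int j))"
    by (simp add: sum.reindex)
  finally have "of_int (lucas_coeff n (int k)) = (\<Sum>j = 0..k div 2.
      of_int (power_sum_coeff (int k - 2 * int j) (int j) (int n - int k + int j)) :: rat)"
    by simp
  moreover have "of_nat n / (of_nat n - of_nat j) * ibinom (int n - int j) (int n - int k + int j)
        * ibinom (int k - int j - 1) (int j)
      = of_int (power_sum_coeff (int k - 2 * int j) (int j) (int n - int k + int j))"
    if "j \<in> {0..k div 2}" for j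
  proof (cases "n + j < k")
    case True
    then show ?thesis by (simp add: ibinom_def)
  next
    case False
    \<comment> \<open>The exponents of \<open>x\<close> and \<open>w\<close> in the monomial that
      \<open>j\<close> contributes to \<open>q^k\<close>.\<close>
    define i l where "i = k - 2 * j" "l = n + j - k"
    have il: "k = i + 2 * j" "n = i + j + l" "i + l > 0"
      using that k False by (auto simp: i_l_def)
    have "int k - int j - 1 = int i + int j - 1" "int n - int j = int (i + l)"
      "int n - int k + int j = int l" "int k - 2 * int j = int i"
      using il by simp_all
    moreover have "of_nat n - of_nat j = (of_nat (i + l) :: rat)" using il by simp
    ultimately show ?thesis
      using power_sum_coeff_closed[OF il(3), of j] il
      by (simp only: ibinom_of_nat ibinom_multichoose mult.assoc)
  qed
  ultimately show ?thesis using k by (simp add: lucas_whitney_def)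
qed

section \<open>Coefficients of Laurent polynomials\<close>

lemma lookup_lmonom_times:
  fixes P :: "'a::comm_ring_1 laurent"
  shows "Poly_Mapping.lookup (lmonom c a * P) k = c * Poly_Mapping.lookup P (k - a)"
proof (induction P rule: update_induct)
  case (update f i d)
  have "Poly_Mapping.update i d f = f + lmonom d i"
    using update(1)
    by (intro poly_mapping_eqI)
      (auto simp: lookup_update lookup_add lookup_single when_def in_keys_iff)
  moreover have "Poly_Mapping.lookup (lmonom c a * lmonom d i) k =
      c * Poly_Mapping.lookup (lmonom d i) (k - a)"
    by (auto simp: mult_single lookup_single when_def)
  ultimately show ?case using update(3) by (simp add: distrib_left lookup_add)
qed simp

lemma lookup_sum_lmonom:
  "Poly_Mapping.lookup (\<Sum>k = 0..N. lmonom (f k) (int k - a)) x =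
     (if 0 \<le> x + a \<and> x + a \<le> int N then f (nat (x + a)) else 0)"
proof -
  have "Poly_Mapping.lookup (\<Sum>k = 0..N. lmonom (f k) (int k - a)) x =
      (\<Sum>k = 0..N. if k = nat (x + a) then (if 0 \<le> x + a then f k else 0) else 0)"
    unfolding lookup_sum by (intro sum.cong) (auto simp: lookup_single when_def)
  then show ?thesis by auto
qed

lemma lookup_lsubst_dvd:
  assumes "m \<noteq> 0"
  shows "Poly_Mapping.lookup (lsubst c m P) x =
    (if m dvd x then Poly_Mapping.lookup P (x div m) * c ^ nat \<bar>x div m\<bar> else 0)"
proof (cases "m dvd x")
  case True
  then obtain k where "x = m * k" ..
  then show ?thesis using lookup_lsubst[OF assms, of c P k] assms by simp
next
  case False
  then show ?thesis
    unfolding lsubst_def lookup_sum by (auto simp: lookup_single when_def intro!: sum.neutral)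
qed

lemma lookup_rat_laurent:
  "Poly_Mapping.lookup (rat_laurent P) k = of_int (Poly_Mapping.lookup P k)"
  unfolding rat_laurent_def by (simp add: map.rep_eq when_def)

section \<open>Traces of powers of a Burau matrix\<close>

text \<open>Cayley-Hamilton for \<open>A\<close>, multiplied by \<open>B\<close> and traced.\<close>

lemma trace_mult_mult:
  fixes A B :: "'a::comm_ring_1 ^ 2 ^ 2"
  shows "trace (A ** (A ** B)) = trace A * trace (A ** B) - det A * trace B"
  by (simp add: trace_def det_2 sum_2 matrix_matrix_mult_def algebra_simps)

lemma matrix_inv_burau_S2: "matrix_inv (burau_gen S2) = vector [vector [1, 0], vector [1, - tinv]]"
proof -
  let ?B = "vector [vector [1, 0], vector [1, - tinv]] :: int laurent ^ 2 ^ 2"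
  have "burau_gen S2 ** ?B = mat 1"
    by (simp add: matrix_matrix_mult_def mat_def vec_eq_iff forall_2 sum_2 tvar_tinv)
  \<comment> \<open>\<open>matrix_inv\<close> is defined by choice, so it is identified with the
    explicit right inverse by cancelling on the left.\<close>
  then have "matrix_inv (burau_gen S2) ** (burau_gen S2 ** ?B) = matrix_inv (burau_gen S2)"
    by simp
  then show ?thesis
    by (simp add: matrix_mul_assoc burau_gen_inverse del: burau_gen.simps)
qed

lemma burau_inverse_sigma: "burau (inverse (sigma g)) = matrix_inv (burau_gen g)"
  by transfer (simp add: inv_word_def burau_word_def)

lemma burau_weaving_1:
  "burau (sigma1 * inverse sigma2) = vector [vector [1 - tvar, - tinv], vector [1, - tinv]]"
  unfolding burau_simps burau_inverse_sigma matrix_inv_burau_S2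
  by (simp add: matrix_matrix_mult_def vec_eq_iff forall_2 sum_2 tvar_tinv)

lemma trace_weaving_0: "trace (burau (weaving_braid 0)) = 2"
  by (simp add: weaving_braid_def burau_simps trace_def mat_def sum_2)

lemma trace_weaving_1: "trace (burau (weaving_braid (Suc 0))) = 1 - tvar - tinv"
  by (simp add: weaving_braid_def burau_weaving_1 trace_def sum_2)

lemma trace_weaving_rec:
  "trace (burau (weaving_braid (Suc (Suc n)))) =
     (1 - tvar - tinv) * trace (burau (weaving_braid (Suc n))) - trace (burau (weaving_braid n))"
proof -
  let ?A = "burau (sigma1 * inverse sigma2)"
  have "det ?A = 1"
    by (simp add: burau_weaving_1 det_2 algebra_simps tvar_tinv)
  moreover have "trace ?A = 1 - tvar - tinv"
    by (simp add: burau_weaving_1 trace_def sum_2)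
  moreover have "burau (weaving_braid (Suc m)) = ?A ** burau (weaving_braid m)" for m
    by (simp only: weaving_braid_def power_Suc burau_simps(2))
  ultimately show ?thesis using trace_mult_mult[of ?A "burau (weaving_braid n)"] by simp
qed

text \<open>The sign comes from \<open>t = -s\<close> and the shift from the factor
  \<open>s^n\<close>; both sides then obey the same recurrence with the same two initial
  values.\<close>

lemma lookup_trace_weaving:
  "Poly_Mapping.lookup (trace (burau (weaving_braid n))) k =
     (-1) ^ nat \<bar>k\<bar> * lucas_coeff n (k + int n)"
proof (induction n arbitrary: k rule: induct_nat_012)
  case 0
  show ?case
    by (auto simp: trace_weaving_0 lucas_coeff_0 lookup_numeral when_def)
next
  case 1
  show ?case
    by (auto simp: trace_weaving_1 lucas_coeff_1 lookup_minus lookup_single lookup_one when_def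
        simp flip: eq_neg_iff_add_eq_0)
next
  case (ge2 n)
  \<comment> \<open>A factor \<open>t\<close> or \<open>1/t\<close> flips the parity of the
    exponent, which turns \<open>1 - t - 1/t\<close> into \<open>1 + s + 1/s\<close>.\<close>
  have sign: "(-1 :: int) ^ nat \<bar>k - 1\<bar> = - ((-1) ^ nat \<bar>k\<bar>)"
      "(-1 :: int) ^ nat \<bar>k + 1\<bar> = - ((-1) ^ nat \<bar>k\<bar>)"
    by (simp_all add: minus_one_power_iff even_nat_iff)
  have "Poly_Mapping.lookup (trace (burau (weaving_braid (Suc (Suc n))))) k =
      (-1) ^ nat \<bar>k\<bar> * lucas_coeff (Suc n) (k + int (Suc n))
      - (-1) ^ nat \<bar>k - 1\<bar> * lucas_coeff (Suc n) (k - 1 + int (Suc n))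
      - (-1) ^ nat \<bar>k + 1\<bar> * lucas_coeff (Suc n) (k + 1 + int (Suc n))
      - (-1) ^ nat \<bar>k\<bar> * lucas_coeff n (k + int n)"
    unfolding trace_weaving_rec left_diff_distrib lookup_minus lookup_lmonom_times ge2
    by (simp add: ge2)
  also have "\<dots> = (-1) ^ nat \<bar>k\<bar> * lucas_coeff (Suc (Suc n)) (k + int (Suc (Suc n)))"
    unfolding sign lucas_coeff_rec[of n] by (simp add: algebra_simps)
  finally show ?case .
qed

section \<open>The Jones polynomial of the weaving links\<close>

lemma exponent_sum_inverse_sigma: "exponent_sum (inverse (sigma g)) = -1"
  by transfer (simp add: inv_word_def exponent_sum_word_def)

lemma exponent_sum_weaving: "exponent_sum (weaving_braid n) = 0"
  unfolding weaving_braid_def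
  by (induction n) (simp_all add: exponent_sum_inverse_sigma)

lemma lookup_shifted_lucas_rank_poly:
  assumes "n \<ge> 1"
  shows "Poly_Mapping.lookup (lmonom 1 (- int n) * lucas_rank_poly n) k =
    of_int (lucas_coeff n (k + int n))"
proof -
  have "Poly_Mapping.lookup (lucas_rank_poly n) x = of_int (lucas_coeff n x)" for x
    using lookup_sum_lmonom[where f = "lucas_whitney n" and a = 0 and N = "2 * n" and x = x] assms
    by (auto simp: lucas_rank_poly_def lucas_whitney_eq lucas_coeff_outside)
  then show ?thesis by (simp add: lookup_lmonom_times)
qed

theorem corollary3p4:
  fixes n :: nat
  assumes "n \<ge> 1"
  shows "rat_laurent (jones_closure (weaving_braid n)) =
      at_s (- lmonom 1 1 - lmonom 1 (-1) + lmonom 1 (- int n) * lucas_rank_poly n) \<and>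
    - lmonom 1 1 - lmonom 1 (-1) + lmonom 1 (- int n) * lucas_rank_poly n =
      (\<Sum>k = 0..2 * n.
        lmonom (if \<bar>int k - int n\<bar> \<noteq> 1 then lucas_whitney n k else lucas_whitney n k - 1)
          (int k - int n))"
proof (intro conjI poly_mapping_eqI)
  have jones: "jones_closure (weaving_braid n) =
      lsubst 1 2 (tvar + tinv + trace (burau (weaving_braid n)))"
    by (simp add: jones_closure_def exponent_sum_weaving)
  \<comment> \<open>Both sides vanish at odd powers of \<open>u\<close>. At \<open>u^(2k)\<close>
    the sign from \<open>at_s\<close> matches that of the trace, and it turns
    \<open>-s - 1/s\<close> into \<open>t + 1/t\<close>.\<close>
  show "Poly_Mapping.lookup (rat_laurent (jones_closure (weaving_braid n))) x =
      Poly_Mapping.lookup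
        (at_s (- lmonom 1 1 - lmonom 1 (-1) + lmonom 1 (- int n) * lucas_rank_poly n)) x" for x
    unfolding jones at_s_def lookup_rat_laurent
    by (auto simp: lookup_lsubst_dvd lookup_add lookup_minus lookup_uminus lookup_single when_def
        lookup_trace_weaving lookup_shifted_lucas_rank_poly[OF assms])
next
  \<comment> \<open>As \<open>n \<ge> 1\<close>, the exponents 1 and -1 lie within the range of the
    sum, so both corrections are absorbed into its coefficients.\<close>
  show "Poly_Mapping.lookup
        (- lmonom 1 1 - lmonom 1 (-1) + lmonom 1 (- int n) * lucas_rank_poly n) x =
      Poly_Mapping.lookup (\<Sum>k = 0..2 * n.
        lmonom (if \<bar>int k - int n\<bar> \<noteq> 1 then lucas_whitney n k else lucas_whitney n k - 1)
          (int k - int n)) x" for x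
    unfolding lookup_sum_lmonom lookup_add lookup_minus lookup_uminus
      lookup_shifted_lucas_rank_poly[OF assms]
    using assms
    by (auto simp: lookup_single when_def lucas_whitney_eq lucas_coeff_outside nat_le_iff)
qed

end
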